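(* Let $\Bbbk$ be an algebraically closed field of characteristic zero and let $A_{c,q}=\Bbbk[x,y,z]/(c(x)z-q(x,y))$ be a Danielewski-type algebra in reduced form with $\deg(c)\ge2$ and $d=\deg_y(q)=2$. Suppose $G_{c,q}=\{(1,1),(1,-1)\}$, and let $\psi:\operatorname{Aut}(A_{c,q})\to G_{c,q}$ be the canonical homomorphism. If $\sigma\in\operatorname{Aut}(A_{c,q})$ satisfies $\psi(\sigma)=(1,-1)$, then $\sigma$ fixes a maximal ideal of $A_{c,q}$, i.e. $\sigma(\mathfrak m)=\mathfrak m$ for some maximal ideal $\mathfrak m$.
   Context: $A_{c,q}$ being in reduced form with $\deg(c)=n\ge2$ and $\deg_y(q)=2$ means: $c(x)\in\Bbbk[x]$ has degree $n$ and zero coefficient of $x^{n-1}$, and $q(x,y)=\lambda y^2+p(x)$ with $\lambda\in\Bbbk^*$, $p\in\Bbbk[x]$, $\deg(p)<n$. The diagonal group is $G_{c,q}=\{(e,u)\in\Bbbk^*\times\Bbbk^*\mid c(ex)=e^nc(x),\ q(ex,uy)=u^2q(x,y)\}$. $\bar x,\bar y,\bar z$ denote the images of $x,y,z$ in $A_{c,q}$, and $\operatorname{Aut}(A_{c,q})$ is the group of $\Bbbk$-algebra automorphisms. It is a known structural fact that every $\sigma\in\operatorname{Aut}(A_{c,q})$ satisfies $\sigma(\bar x)=e\bar x$, $\sigma(\bar y)=u\bar y+c(\bar x)\ell(\bar x)$ for some $(e,u)\in G_{c,q}$ and $\ell\in\Bbbk[x]$; the canonical homomorphism $\psi$ is the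 group homomorphism $\psi(\sigma)=(e,u)$. *)

theory Defs
  imports "HOL-Algebra.Algebra" "HOL-Algebra.Algebraic_Closure_Type"
begin

text \<open>
  The polynomial ring in \<open>x, y, z\<close> over \<open>'k\<close> is \<open>'k poly poly poly\<close>: the innermost variable
  is \<open>x\<close>, the middle one \<open>y\<close>, the outermost one \<open>z\<close>.  Thus \<open>c(x)\<close> has type \<open>'k poly\<close>,
  \<open>q(x,y)\<close> has type \<open>'k poly poly\<close>, and \<open>degree q\<close> is the degree in \<open>y\<close>.
\<close>

type_synonym 'k poly3 = "'k poly poly poly"

definition var_x :: "'k::field poly3" where
  "var_x = [:[:[:0, 1:]:]:]"

definition var_y :: "'k::field poly3" where
  "var_y = [:[:0, 1:]:]"

definition var_z :: "'k::field poly3" where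
  "var_z = [:0, 1:]"

definition poly3_of_x :: "'k::field poly \<Rightarrow> 'k poly3" where
  "poly3_of_x r = [:[:r:]:]"

definition poly3_of_xy :: "'k::field poly poly \<Rightarrow> 'k poly3" where
  "poly3_of_xy r = [:r:]"

definition danielewski_ideal :: "'k::field poly \<Rightarrow> 'k poly poly \<Rightarrow> 'k poly3 set" where
  "danielewski_ideal c q =
     PIdl\<^bsub>ring_of_type_algebra\<^esub> (poly3_of_x c * var_z - poly3_of_xy q)"

definition danielewski :: "'k::field poly \<Rightarrow> 'k poly poly \<Rightarrow> 'k poly3 set ring" where
  "danielewski c q = ring_of_type_algebra Quot danielewski_ideal c q"

definition residue_class :: "'k::field poly \<Rightarrow> 'k poly poly \<Rightarrow> 'k poly3 \<Rightarrow> 'k poly3 set" where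
  "residue_class c q f = danielewski_ideal c q +>\<^bsub>ring_of_type_algebra\<^esub> f"

definition scalar :: "'k::field poly \<Rightarrow> 'k poly poly \<Rightarrow> 'k \<Rightarrow> 'k poly3 set" where
  "scalar c q a = residue_class c q (poly3_of_x [:a:])"

text \<open>This is the reduced form for \<open>q\<close> quadratic in \<open>y\<close>, and it is meant for \<open>degree c \<ge> 2\<close>.\<close>

definition reduced_form :: "'k::field poly \<Rightarrow> 'k poly poly \<Rightarrow> bool" where
  "reduced_form c q \<longleftrightarrow>
     Polynomial.coeff c (Polynomial.degree c - 1) = 0 \<and>
     (\<exists>lam p. lam \<noteq> 0 \<and> Polynomial.degree p < Polynomial.degree c \<and> q = [:p, 0, [:lam:]:])"

definition scale_x :: "'k::field \<Rightarrow> 'k poly \<Rightarrow> 'k poly" where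
  "scale_x e r = pcompose r [:0, e:]"

definition scale_xy :: "'k::field \<Rightarrow> 'k \<Rightarrow> 'k poly poly \<Rightarrow> 'k poly poly" where
  "scale_xy e u r = pcompose (map_poly (scale_x e) r) [:0, [:u:]:]"

definition diagonal_group :: "'k::field poly \<Rightarrow> 'k poly poly \<Rightarrow> ('k \<times> 'k) set" where
  "diagonal_group c q =
     {(e, u). e \<noteq> 0 \<and> u \<noteq> 0 \<and>
        scale_x e c = Polynomial.smult (e ^ Polynomial.degree c) c \<and>
        scale_xy e u q = Polynomial.smult [:u ^ 2:] q}"

definition algebra_auto :: "'k::field poly \<Rightarrow> 'k poly poly \<Rightarrow> ('k poly3 set \<Rightarrow> 'k poly3 set) set" where
  "algebra_auto c q =
     {\<sigma> \<in> ring_hom (danielewski c q) (danielewski c q) \<inter> Bij (carrier (danielewski c q)).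
        \<forall>a. \<sigma> (scalar c q a) = scalar c q a}"

definition has_canonical_form ::
  "'k::field poly \<Rightarrow> 'k poly poly \<Rightarrow> ('k poly3 set \<Rightarrow> 'k poly3 set) \<Rightarrow> 'k \<times> 'k \<Rightarrow> bool" where
  "has_canonical_form c q \<sigma> = (\<lambda>(e, u).
     (e, u) \<in> diagonal_group c q \<and>
     \<sigma> (residue_class c q var_x) =
       scalar c q e \<otimes>\<^bsub>danielewski c q\<^esub> residue_class c q var_x \<and>
     (\<exists>l. \<sigma> (residue_class c q var_y) =
       (scalar c q u \<otimes>\<^bsub>danielewski c q\<^esub> residue_class c q var_y)
       \<oplus>\<^bsub>danielewski c q\<^esub>
       (residue_class c q (poly3_of_x c) \<otimes>\<^bsub>danielewski c q\<^esub> residue_class c q (poly3_of_x l))))"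

text \<open>
  By the structure theorem for automorphisms, the \<open>else\<close> branch is never taken when
  \<open>\<sigma> \<in> algebra_auto c q\<close> and \<open>(c, q)\<close> is in reduced form with \<open>degree c \<ge> 2\<close>.  Its value lies
  outside the diagonal group, so an equation \<open>psi c q \<sigma> = (e, u)\<close> with \<open>(e, u)\<close> in the diagonal
  group always says that \<open>\<sigma>\<close> has the canonical form with parameters \<open>(e, u)\<close>.
\<close>

definition psi ::
  "'k::field poly \<Rightarrow> 'k poly poly \<Rightarrow> ('k poly3 set \<Rightarrow> 'k poly3 set) \<Rightarrow> 'k \<times> 'k" where
  "psi c q \<sigma> =
     (if \<exists>g. has_canonical_form c q \<sigma> g then THE g. has_canonical_form c q \<sigma> g else (0, 0))"

text \<open>The parameters are determined by the automorphism, so the description in \<open>psi\<close> is proper.\<close>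

lemma residue_class_eq_iff:
  "residue_class c q f = residue_class c q g \<longleftrightarrow>
     (\<exists>h. f - g = h * (poly3_of_x c * var_z - poly3_of_xy q))"
proof -
  let ?R = "ring_of_type_algebra :: 'a poly3 ring"
  interpret cring ?R by (rule cring_from_type_algebra)
  have I: "ideal (danielewski_ideal c q) ?R"
    unfolding danielewski_ideal_def
    by (rule cgenideal_ideal) (simp add: ring_of_type_algebra_def)
  have mem: "a \<in> danielewski_ideal c q \<longleftrightarrow>
      (\<exists>h. a = h * (poly3_of_x c * var_z - poly3_of_xy q))" for a
    by (auto simp: danielewski_ideal_def cgenideal_def ring_of_type_algebra_def)
  have neg: "\<ominus>\<^bsub>?R\<^esub> g = - g"
    by (rule minus_equality) (auto simp: ring_of_type_algebra_def)
  have "residue_class c q f = residue_class c q g \<longleftrightarrow> f - g \<in> danielewski_ideal c q"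
    using quotient_eq_iff_same_a_r_cos[OF I, of f g] neg
    by (simp add: residue_class_def ring_of_type_algebra_def a_minus_def)
  then show ?thesis by (simp add: mem)
qed

lemma residue_class_mult:
  "residue_class c q f \<otimes>\<^bsub>danielewski c q\<^esub> residue_class c q g = residue_class c q (f * g)"
proof -
  let ?R = "ring_of_type_algebra :: 'a poly3 ring"
  interpret cring ?R by (rule cring_from_type_algebra)
  have I: "ideal (danielewski_ideal c q) ?R"
    unfolding danielewski_ideal_def
    by (rule cgenideal_ideal) (simp add: ring_of_type_algebra_def)
  show ?thesis
    using ring_hom_mult[OF ideal.rcos_ring_hom[OF I], of f g]
    by (simp add: residue_class_def danielewski_def) (simp add: ring_of_type_algebra_def)
qed

lemma residue_class_add:
  "residue_class c q f \<oplus>\<^bsub>danielewski c q\<^esub> residue_class c q g = residue_class c q (f + g)"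
proof -
  let ?R = "ring_of_type_algebra :: 'a poly3 ring"
  interpret cring ?R by (rule cring_from_type_algebra)
  have I: "ideal (danielewski_ideal c q) ?R"
    unfolding danielewski_ideal_def
    by (rule cgenideal_ideal) (simp add: ring_of_type_algebra_def)
  show ?thesis
    using ring_hom_add[OF ideal.rcos_ring_hom[OF I], of f g]
    by (simp add: residue_class_def danielewski_def) (simp add: ring_of_type_algebra_def)
qed

lemma residue_class_const_eqD:
  assumes "c \<noteq> 0" "residue_class c q [:f:] = residue_class c q [:g:]"
  shows "f = g"
proof -
  let ?r = "poly3_of_x c * var_z - poly3_of_xy q"
  obtain h where h: "[:f:] - [:g:] = h * ?r"
    using assms(2) by (auto simp: residue_class_eq_iff)
  have r: "?r = [:- q, [:c:]:]"
    by (simp add: poly3_of_x_def var_z_def poly3_of_xy_def)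
  then have d: "Polynomial.degree ?r = 1" "?r \<noteq> 0" using assms(1) by auto
  have "h = 0"
  proof (rule ccontr)
    assume "h \<noteq> 0"
    then have "Polynomial.degree (h * ?r) = Polynomial.degree h + 1"
      using d by (simp add: degree_mult_eq)
    moreover have "Polynomial.degree ([:f:] - [:g:]) = 0" by simp
    ultimately show False unfolding h by simp
  qed
  then show ?thesis using h by simp
qed

lemma has_canonical_form_unique:
  assumes c: "c \<noteq> 0"
    and 1: "has_canonical_form c q \<sigma> g" and 2: "has_canonical_form c q \<sigma> g'"
  shows "g = g'"
proof -
  obtain e u e' u' where g: "g = (e, u)" "g' = (e', u')" by (metis surj_pair)
  note simps = has_canonical_form_def scalar_def residue_class_mult residue_class_add
    poly3_of_x_def var_x_def var_y_def
  have "residue_class c q [:[:[:0, e:]:]:] = residue_class c q [:[:[:0, e':]:]:]"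
    using 1 2 unfolding g by (simp add: simps)
  from residue_class_const_eqD[OF c this] have e: "e = e'" by simp
  obtain l l' where
    "residue_class c q [:[:c * l, [:u:]:]:] = residue_class c q [:[:c * l', [:u':]:]:]"
    using 1 2 unfolding g by (fastforce simp add: simps)
  from residue_class_const_eqD[OF c this] have "u = u'" by simp
  with e show ?thesis by (simp add: g)
qed

end

theory Submission
  imports Defs
begin

text \<open>
  Geometrically, \<open>\<sigma>\<close> acts on the surface \<open>c(x) z = q(x,y)\<close>, and a maximal ideal fixed by \<open>\<sigma>\<close> is
  found as the ideal of a fixed point.  If \<open>\<psi>(\<sigma>) = (1,-1)\<close>, then \<open>\<sigma>\<close> fixes \<open>x\<close> and sends \<open>y\<close> to
  \<open>-y + c(x) l(x)\<close>, so on every fibre \<open>x = a\<close> it acts on the \<open>y\<close>-coordinate as a reflection, whose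
  centre is \<open>b = c(a) l(a) / 2\<close>.  Where \<open>c(a) \<noteq> 0\<close>, the surface is the graph of
  \<open>z = q(x,y) / c(x)\<close>.  Hence exactly one point \<open>(a, b, w)\<close> lies over \<open>(a, b)\<close>, and it must be fixed
  along with \<open>(a, b)\<close>.  A suitable \<open>a\<close> exists because a nonzero polynomial over an infinite field
  has a non-root.

  Algebraically, a point of the surface is the homomorphism \<open>value_at a b w\<close> from the coordinate
  ring to the field.  That the point is fixed means that this homomorphism is unchanged by
  composition with \<open>\<sigma>\<close> (\<open>value_at_auto_invariant\<close>), and this suffices to be checked on
  generators.  The kernel is then a maximal ideal
  (\<open>ring_hom_ring.kernel_maximal\<close>) that \<open>\<sigma>\<close> maps onto itself (\<open>image_kernel_invariant\<close>).
\<close>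

text \<open>
  An element outside the kernel maps to a unit of the field; lifting the inverse of its image makes
  it invertible modulo the kernel, so together with the kernel it generates the whole ring.
\<close>

lemma (in ring_hom_ring) kernel_maximal:
  assumes "field S" and surj: "h ` carrier R = carrier S"
  shows "maximalideal (a_kernel R S h) R"
proof (rule maximalidealI)
  interpret S: field S by fact
  show "ideal (a_kernel R S h) R" by (rule kernel_is_ideal)
  have "\<one> \<notin> a_kernel R S h"
    by (simp only: a_kernel_def' mem_Collect_eq hom_one S.one_not_zero simp_thms)
  then show "carrier R \<noteq> a_kernel R S h" by blast
next
  fix J assume "ideal J R" and sub: "a_kernel R S h \<subseteq> J" and JR: "J \<subseteq> carrier R"
  interpret S: field S by fact
  interpret J: ideal J R by fact
  show "J = a_kernel R S h \<or> J = carrier R"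
  proof (rule disjCI)
    assume "J \<noteq> carrier R"
    show "J = a_kernel R S h"
    proof (rule ccontr)
      assume "J \<noteq> a_kernel R S h"
      with sub JR obtain s where s: "s \<in> J" "s \<in> carrier R" "h s \<noteq> \<zero>\<^bsub>S\<^esub>"
        by (auto simp only: a_kernel_def')
      then have "h s \<in> Units S" by (simp add: S.field_Units)
      then have inv: "inv\<^bsub>S\<^esub> h s \<in> carrier S" "h s \<otimes>\<^bsub>S\<^esub> inv\<^bsub>S\<^esub> h s = \<one>\<^bsub>S\<^esub>" by auto
      with surj obtain t where t: "t \<in> carrier R" "h t = inv\<^bsub>S\<^esub> h s" by (metis imageE)
      have st: "s \<otimes> t \<in> carrier R" "h (s \<otimes> t) = \<one>\<^bsub>S\<^esub>" using s t inv by simp_all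
      have "h (\<one> \<ominus> s \<otimes> t) = h \<one> \<oplus>\<^bsub>S\<^esub> \<ominus>\<^bsub>S\<^esub> h (s \<otimes> t)"
        unfolding R.minus_eq using st(1) by (simp only: hom_add hom_a_inv R.a_inv_closed R.one_closed)
      also have "\<dots> = \<zero>\<^bsub>S\<^esub>"
        unfolding st(2) hom_one by (rule S.r_neg[OF S.one_closed])
      finally have "\<one> \<ominus> s \<otimes> t \<in> a_kernel R S h"
        using st(1) by (simp only: a_kernel_def' mem_Collect_eq R.minus_closed R.one_closed)
      then have "\<one> \<ominus> s \<otimes> t \<in> J" using sub by blast
      moreover have "s \<otimes> t \<in> J" using s t by (simp add: J.I_r_closed)
      ultimately have "(\<one> \<ominus> s \<otimes> t) \<oplus> s \<otimes> t \<in> J" by simp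
      then have "\<one> \<in> J" using st(1) by (simp add: R.minus_eq R.a_assoc R.l_neg)
      then have "J = carrier R" by (rule J.one_imp_carrier)
      with \<open>J \<noteq> carrier R\<close> show False by (rule notE)
    qed
  qed
qed

text \<open>
  Invariance of \<open>ev\<close> by itself gives the inclusion of the image in the kernel.  Equality holds
  because the preimage under \<open>\<sigma>\<close> of an element of the kernel has the same value, zero.
\<close>

lemma image_kernel_invariant:
  assumes bij: "bij_betw \<sigma> (carrier R) (carrier R)"
    and inv: "\<And>U. U \<in> carrier R \<Longrightarrow> ev (\<sigma> U) = ev U"
  shows "\<sigma> ` a_kernel R S ev = a_kernel R S ev"
proof -
  have "\<exists>U \<in> carrier R. V = \<sigma> U" if "V \<in> carrier R" for V
    using bij that by (metis bij_betw_imp_surj_on imageE)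
  moreover have "\<sigma> U \<in> carrier R" if "U \<in> carrier R" for U
    using bij that by (rule bij_betwE[THEN bspec])
  ultimately show ?thesis
    using inv by (fastforce simp: a_kernel_def')
qed

definition point_eval :: "'k::field \<Rightarrow> 'k \<Rightarrow> 'k \<Rightarrow> 'k poly3 \<Rightarrow> 'k" where
  "point_eval a b w f = poly (poly (poly f [:[:w:]:]) [:b:]) a"

lemma point_eval_simps [simp]:
  "point_eval a b w (f + g) = point_eval a b w f + point_eval a b w g"
  "point_eval a b w (f - g) = point_eval a b w f - point_eval a b w g"
  "point_eval a b w (f * g) = point_eval a b w f * point_eval a b w g"
  "point_eval a b w 1 = 1"
  "point_eval a b w (poly3_of_x r) = poly r a"
  "point_eval a b w (poly3_of_xy s) = poly (poly s [:b:]) a"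
  "point_eval a b w var_x = a" "point_eval a b w var_y = b" "point_eval a b w var_z = w"
  by (simp_all add: point_eval_def poly3_of_x_def poly3_of_xy_def var_x_def var_y_def var_z_def)

text \<open>
  Generation of the polynomial ring by scalars and variables takes the form of two induction rules,
  one for the part without \<open>z\<close> and one for the whole ring.  The value of a homomorphism at \<open>z\<close> is
  deduced below from its values at \<open>c(x)\<close> and \<open>q(x,y)\<close>, so the first rule must be available
  before anything is known about \<open>z\<close>.
\<close>

lemma poly3_of_xy_induct [case_names const x y add mult]:
  fixes s :: "'k::field poly poly"
  assumes const: "\<And>k. P (poly3_of_x [:k:])" and x: "P var_x" and y: "P var_y"
    and add: "\<And>f g. P f \<Longrightarrow> P g \<Longrightarrow> P (f + g)" and mult: "\<And>f g. P f \<Longrightarrow> P g \<Longrightarrow> P (f * g)"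
  shows "P (poly3_of_xy s)"
proof -
  have zero: "P 0" using const[of 0] by (simp add: poly3_of_x_def)
  have P_x: "P [:[:r:]:]" for r :: "'k poly"
  proof (induction r)
    case (pCons k r)
    have "[:[:pCons k r:]:] = poly3_of_x [:k:] + var_x * [:[:r:]:]"
      by (simp add: poly3_of_x_def var_x_def)
    then show ?case by (simp only: add mult const x pCons.IH)
  qed (simp add: zero)
  have "P [:s:]"
  proof (induction s)
    case (pCons r s)
    have "[:pCons r s:] = [:[:r:]:] + var_y * [:s:]" by (simp add: var_y_def)
    then show ?case by (simp only: add mult P_x y pCons.IH)
  qed (simp add: zero)
  then show ?thesis by (simp add: poly3_of_xy_def)
qed

lemma poly3_induct [case_names xy z add mult]:
  fixes f :: "'k::field poly3"
  assumes xy: "\<And>s. P (poly3_of_xy s)" and z: "P var_z"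
    and add: "\<And>f g. P f \<Longrightarrow> P g \<Longrightarrow> P (f + g)" and mult: "\<And>f g. P f \<Longrightarrow> P g \<Longrightarrow> P (f * g)"
  shows "P f"
proof (induction f)
  case 0
  show ?case using xy[of 0] by (simp add: poly3_of_xy_def)
next
  case (pCons s f)
  have "pCons s f = poly3_of_xy s + var_z * f" by (simp add: var_z_def poly3_of_xy_def)
  then show ?case by (simp only: add mult xy z pCons.IH)
qed

lemma danielewski_ideal_ideal: "ideal (danielewski_ideal c q) ring_of_type_algebra"
  unfolding danielewski_ideal_def
  by (rule cring.cgenideal_ideal[OF cring_from_type_algebra]) (simp add: ring_of_type_algebra_def)

lemma ring_danielewski: "ring (danielewski c q)"
  unfolding danielewski_def by (rule ideal.quotient_is_ring[OF danielewski_ideal_ideal])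

lemma carrier_danielewski: "carrier (danielewski c q) = range (residue_class c q)"
  by (auto simp: danielewski_def FactRing_def A_RCOSETS_def' residue_class_def)
    (auto simp: ring_of_type_algebra_def)

lemma one_danielewski: "\<one>\<^bsub>danielewski c q\<^esub> = residue_class c q 1"
  by (simp add: danielewski_def FactRing_def residue_class_def) (simp add: ring_of_type_algebra_def)

lemma mem_residue_class_self: "f \<in> residue_class c q f"
proof -
  interpret I: ideal "danielewski_ideal c q" ring_of_type_algebra by (rule danielewski_ideal_ideal)
  show ?thesis unfolding residue_class_def
    by (rule I.a_rcos_self) (simp add: ring_of_type_algebra_def)
qed

lemma residue_class_eq_of_mem:
  assumes "g \<in> residue_class c q f"
  shows "residue_class c q g = residue_class c q f"
proof -
  interpret I: ideal "danielewski_ideal c q" ring_of_type_algebra by (rule danielewski_ideal_ideal)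
  show ?thesis using assms unfolding residue_class_def
    by (intro I.a_repr_independence[symmetric] I.a_subgroup)
      (simp_all add: ring_of_type_algebra_def)
qed

text \<open>
  The value of a function on the surface at \<open>(a, b, w)\<close>.  All representatives of a residue class
  agree there precisely when the point lies on the surface; only then is the use of \<open>the_elem\<close>
  meaningful.
\<close>

definition value_at :: "'k::field \<Rightarrow> 'k \<Rightarrow> 'k \<Rightarrow> 'k poly3 set \<Rightarrow> 'k" where
  "value_at a b w U = the_elem (point_eval a b w ` U)"

lemma value_at_residue_class:
  assumes on: "poly c a * w = poly (poly q [:b:]) a"
  shows "value_at a b w (residue_class c q f) = point_eval a b w f"
proof -
  have "point_eval a b w g = point_eval a b w f" if g: "g \<in> residue_class c q f" for g
  proof -
    obtain h where "g - f = h * (poly3_of_x c * var_z - poly3_of_xy q)"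
      using residue_class_eq_of_mem[OF g] by (auto simp: residue_class_eq_iff)
    then have "point_eval a b w (g - f) =
        point_eval a b w (h * (poly3_of_x c * var_z - poly3_of_xy q))"
      by (rule arg_cong)
    then show ?thesis using on by simp
  qed
  then have "point_eval a b w ` residue_class c q f = {point_eval a b w f}"
    using mem_residue_class_self by fastforce
  then show ?thesis by (simp add: value_at_def)
qed

lemma value_at_hom:
  assumes on: "poly c a * w = poly (poly q [:b:]) a"
  shows "value_at a b w \<in> ring_hom (danielewski c q) ring_of_type_algebra"
proof (rule ring_hom_memI)
  note at_class = value_at_residue_class[OF on]
  fix U V assume "U \<in> carrier (danielewski c q)" "V \<in> carrier (danielewski c q)"
  then obtain f g where UV: "U = residue_class c q f" "V = residue_class c q g"
    by (auto simp: carrier_danielewski)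
  show "value_at a b w (U \<otimes>\<^bsub>danielewski c q\<^esub> V) =
      value_at a b w U \<otimes>\<^bsub>ring_of_type_algebra\<^esub> value_at a b w V"
    by (simp add: UV residue_class_mult at_class) (simp add: ring_of_type_algebra_def)
  show "value_at a b w (U \<oplus>\<^bsub>danielewski c q\<^esub> V) =
      value_at a b w U \<oplus>\<^bsub>ring_of_type_algebra\<^esub> value_at a b w V"
    by (simp add: UV residue_class_add at_class) (simp add: ring_of_type_algebra_def)
qed (simp_all add: one_danielewski value_at_residue_class[OF on] ring_of_type_algebra_def)

lemma maximalideal_of_point:
  fixes c :: "'k::field poly"
  assumes on: "poly c a * w = poly (poly q [:b:]) a"
  shows "maximalideal (a_kernel (danielewski c q) ring_of_type_algebra (value_at a b w))
    (danielewski c q)"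
proof (rule ring_hom_ring.kernel_maximal)
  show "ring_hom_ring (danielewski c q) ring_of_type_algebra (value_at a b w)"
    by (intro ring_hom_ringI2 ring_danielewski ring_from_type_algebra value_at_hom[OF on])
  show "field (ring_of_type_algebra :: 'k ring)" by (rule field_from_type_algebra)
  have "k \<in> value_at a b w ` carrier (danielewski c q)" for k
    by (rule image_eqI[of _ _ "residue_class c q (poly3_of_x [:k:])"])
      (simp_all add: value_at_residue_class[OF on] carrier_danielewski)
  then show "value_at a b w ` carrier (danielewski c q) = carrier ring_of_type_algebra"
    by (auto simp: ring_of_type_algebra_def)
qed

text \<open>
  Off the zeros of \<open>c\<close>, a point of the surface is determined by its first two coordinates, so it is
  fixed as soon as these are.  In algebraic terms, the values of \<open>z\<close> and of \<open>\<sigma>(z)\<close> both solve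
  the equation \<open>c(a) t = q(a, b)\<close> in the field, which has a single solution.
\<close>

lemma value_at_auto_invariant:
  fixes c :: "'k::field poly"
  assumes auto: "\<sigma> \<in> algebra_auto c q"
    and on: "poly c a * w = poly (poly q [:b:]) a" and ca: "poly c a \<noteq> 0"
    and x: "value_at a b w (\<sigma> (residue_class c q var_x)) = a"
    and y: "value_at a b w (\<sigma> (residue_class c q var_y)) = b"
    and U: "U \<in> carrier (danielewski c q)"
  shows "value_at a b w (\<sigma> U) = value_at a b w U"
proof -
  let ?A = "danielewski c q" and ?K = "ring_of_type_algebra :: 'k ring"
  define \<phi> where "\<phi> f = value_at a b w (\<sigma> (residue_class c q f))" for f
  have "\<sigma> \<in> ring_hom ?A ?A" using auto by (simp add: algebra_auto_def)
  then have hom: "value_at a b w \<circ> \<sigma> \<in> ring_hom ?A ?K"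
    using value_at_hom[OF on] by (rule ring_hom_trans)
  have carr: "residue_class c q f \<in> carrier ?A" for f by (simp add: carrier_danielewski)
  have add: "\<phi> (f + g) = \<phi> f + \<phi> g" for f g
    using ring_hom_add[OF hom carr[of f] carr[of g]]
    by (simp add: residue_class_add \<phi>_def) (simp add: ring_of_type_algebra_def)
  have mult: "\<phi> (f * g) = \<phi> f * \<phi> g" for f g
    using ring_hom_mult[OF hom carr[of f] carr[of g]]
    by (simp add: residue_class_mult \<phi>_def) (simp add: ring_of_type_algebra_def)
  have const: "\<phi> (poly3_of_x [:k:]) = k" for k
    using auto value_at_residue_class[OF on, of "poly3_of_x [:k:]"]
    by (simp add: \<phi>_def algebra_auto_def scalar_def)
  have xy: "\<phi> (poly3_of_xy s) = point_eval a b w (poly3_of_xy s)" for s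
    by (induction rule: poly3_of_xy_induct)
      (simp_all add: const add mult x[folded \<phi>_def] y[folded \<phi>_def])
  have z: "\<phi> var_z = w"
  proof -
    have "residue_class c q (poly3_of_x c * var_z) = residue_class c q (poly3_of_xy q)"
      unfolding residue_class_eq_iff by (intro exI[of _ 1]) simp
    then have "\<phi> (poly3_of_x c * var_z) = \<phi> (poly3_of_xy q)" by (simp add: \<phi>_def)
    moreover have "\<phi> (poly3_of_x c) = poly c a"
      using xy[of "[:c:]"] by (simp add: poly3_of_x_def poly3_of_xy_def point_eval_def)
    ultimately have "poly c a * \<phi> var_z = poly c a * w"
      using on by (simp add: mult xy)
    with ca show ?thesis by simp
  qed
  have "\<phi> f = point_eval a b w f" for f
    by (induction f rule: poly3_induct) (simp_all add: xy z add mult del: point_eval_simps(6))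
  with U show ?thesis by (auto simp: carrier_danielewski \<phi>_def value_at_residue_class[OF on])
qed

text \<open>The default value \<open>(0, 0)\<close> of \<open>psi\<close> is ruled out by the last hypothesis.\<close>

lemma psi_has_canonical_form:
  assumes "c \<noteq> 0" and "psi c q \<sigma> = g" and "g \<noteq> (0, 0)"
  shows "has_canonical_form c q \<sigma> g"
proof -
  have ex: "\<exists>g. has_canonical_form c q \<sigma> g"
    using assms(2,3) by (auto simp: psi_def split: if_splits)
  then have "has_canonical_form c q \<sigma> (THE g. has_canonical_form c q \<sigma> g)"
    using has_canonical_form_unique[OF \<open>c \<noteq> 0\<close>] by (metis theI)
  with ex assms(2) show ?thesis by (simp add: psi_def)
qed

theorem lemma18:
  fixes c :: "'k::{alg_closed_field, field_char_0} poly"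
    and q :: "'k poly poly"
    and \<sigma> :: "'k poly3 set \<Rightarrow> 'k poly3 set"
  assumes "Polynomial.degree c \<ge> 2"
    and "Polynomial.degree q = 2"
    and "reduced_form c q"
    and "diagonal_group c q = {(1, 1), (1, -1)}"
    and "\<sigma> \<in> algebra_auto c q"
    and "psi c q \<sigma> = (1, -1)"
  shows "\<exists>m. maximalideal m (danielewski c q) \<and> \<sigma> ` m = m"
proof -
  have "c \<noteq> 0" using assms(1) by auto
  then obtain a where ca: "poly c a \<noteq> 0" using poly_all_0_iff_0 by blast
  from psi_has_canonical_form[OF \<open>c \<noteq> 0\<close> assms(6)] obtain l where
    x: "\<sigma> (residue_class c q var_x) = residue_class c q (poly3_of_x [:1:] * var_x)" and
    y: "\<sigma> (residue_class c q var_y) =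
      residue_class c q (poly3_of_x [:-1:] * var_y + poly3_of_x c * poly3_of_x l)"
    by (auto simp: has_canonical_form_def scalar_def residue_class_mult residue_class_add)
  \<comment> \<open>the centre of the reflection that sends \<open>y\<close> to \<open>- y + c(a) l(a)\<close>\<close>
  define b where "b = poly c a * poly l a / 2"
  define w where "w = poly (poly q [:b:]) a / poly c a"
  have on: "poly c a * w = poly (poly q [:b:]) a" using ca by (simp add: w_def)
  have "value_at a b w (\<sigma> (residue_class c q var_x)) = a"
    by (simp add: x value_at_residue_class[OF on])
  moreover have "value_at a b w (\<sigma> (residue_class c q var_y)) = b"
    by (simp add: y value_at_residue_class[OF on]) (simp add: b_def)
  ultimately have "value_at a b w (\<sigma> U) = value_at a b w U"
    if "U \<in> carrier (danielewski c q)" for U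
    using value_at_auto_invariant[OF assms(5) on ca] that by blast
  moreover have "bij_betw \<sigma> (carrier (danielewski c q)) (carrier (danielewski c q))"
    using assms(5) by (auto simp: algebra_auto_def Bij_def)
  ultimately show ?thesis
    using image_kernel_invariant maximalideal_of_point[OF on] by metis
qed

end
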